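(* Let $\nabla$ be a torsion-free connection with symmetric projective Schouten tensor on an $n$-dimensional manifold $M$, and let $(g^{ab},\mu^a,\rho)$, with $g^{ab}$ a symmetric tensor, $\mu^a$ a vector field and $\rho$ a function on $M$, satisfy the system $$\begin{aligned}&\mathrm Dg^{bc}=\mu^c\theta^b+\mu^b\theta^c,\\&\mathrm D\mu^b=\rho\,\theta^b-\omega_cg^{bc}-\tfrac1nW^b_{~cda}g^{cd}\theta^a,\\&\mathrm D\rho=-2\omega_b\mu^b+\tfrac2nY_{abc}g^{bc}\theta^a.\end{aligned}$$ Then the integrability condition $\mathrm D^2\rho=0$ is equivalent to $$U_{[ab]cd}\,g^{cd}=-\tfrac{n+3}2\,Y_{bac}\,\mu^c,$$ where $$U_{[ab]cd}=\nabla_{[a}Y_{b](cd)}+W^e_{~(cd)[a}\mathsf P_{b]e}.$$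
   Context: $n\ge2$; $(\theta^a)$ is a local coframe dual to a frame $(X_a)$; the connection 1-forms of $\nabla$ are $\Gamma^a_{~b}=\Gamma^a_{~bc}\theta^c$ with $\nabla_{X_a}X_b=\Gamma^c_{~ba}X_c$. $\mathrm D$ is the covariant exterior differential on tensor-valued forms (on tensor-valued functions $\mathrm DK=\theta^c\nabla_cK$). Curvature: $\Omega^a_{~b}=d\Gamma^a_{~b}+\Gamma^a_{~c}\wedge\Gamma^c_{~b}=\frac12R^a_{~bcd}\theta^c\wedge\theta^d$, $R_{ab}=R^c_{~acb}$. Projective Schouten tensor: $\mathsf P_{ab}=\frac1{n-1}R_{(ab)}-\frac1{n+1}R_{[ab]}$, assumed symmetric here, and $\omega_b=\theta^a\mathsf P_{ab}$. Projective Weyl tensor: $W^a_{~bcd}=R^a_{~bcd}-\delta^a_{~c}\mathsf P_{db}+\delta^a_{~d}\mathsf P_{cb}+2\delta^a_{~b}\mathsf P_{[cd]}$. Projective Cotton tensor: $Y_{bca}=2\nabla_{[b}\mathsf P_{c]a}$. Round (square) brackets denote symmetrization (antisymmetrization) over the two enclosed indices with factor $\frac12$; in $\nabla_{[a}Y_{b](cd)}$ and $W^e_{~(cd)[a}\mathsf P_{b]e}$ one antisymmetrizes in $a,b$ and symmetrizes in $c,d$. *)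

theory Defs
  imports "HOL-Analysis.Analysis"
begin

section \<open>Smooth manifolds\<close>

(* C^k on an open subset of a finite-dimensional space, by recursion on directional derivatives. *)
primrec Ck_on :: "nat \<Rightarrow> ('a::real_normed_vector \<Rightarrow> 'b::real_normed_vector) \<Rightarrow> 'a set \<Rightarrow> bool" where
  "Ck_on 0 f S \<longleftrightarrow> continuous_on S f"
| "Ck_on (Suc k) f S \<longleftrightarrow>
     (\<forall>x\<in>S. f differentiable (at x)) \<and> (\<forall>v. Ck_on k (\<lambda>x. frechet_derivative f (at x) v) S)"

definition smooth_on :: "('a::real_normed_vector \<Rightarrow> 'b::real_normed_vector) \<Rightarrow> 'a set \<Rightarrow> bool" where
  "smooth_on f S \<longleftrightarrow> (\<forall>k. Ck_on k f S)"

type_synonym ('m, 'n) atlas = "('m set \<times> ('m \<Rightarrow> real ^ 'n)) set"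

(* The manifold is the whole type 'm, of dimension CARD('n); the Hausdorff and second
   countability axioms are carried by the type classes. *)
definition smooth_manifold :: "('m::{t2_space,second_countable_topology}, 'n::finite) atlas \<Rightarrow> bool" where
  "smooth_manifold A \<longleftrightarrow>
     (\<Union>(V, \<phi>)\<in>A. V) = UNIV \<and>
     (\<forall>(V, \<phi>)\<in>A. open V \<and> open (\<phi> ` V) \<and> homeomorphism V (\<phi> ` V) \<phi> (inv_into V \<phi>)) \<and>
     (\<forall>(V, \<phi>)\<in>A. \<forall>(W, \<psi>)\<in>A. smooth_on (\<psi> \<circ> inv_into V \<phi>) (\<phi> ` (V \<inter> W)))"

definition smooth_fun :: "('m::topological_space, 'n::finite) atlas \<Rightarrow> 'm set \<Rightarrow> ('m \<Rightarrow> real) \<Rightarrow> bool" where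
  "smooth_fun A U f \<longleftrightarrow> (\<forall>(V, \<phi>)\<in>A. smooth_on (f \<circ> inv_into V \<phi>) (\<phi> ` (V \<inter> U)))"

definition smooth_near :: "('m::topological_space, 'n::finite) atlas \<Rightarrow> 'm \<Rightarrow> ('m \<Rightarrow> real) \<Rightarrow> bool" where
  "smooth_near A p f \<longleftrightarrow> (\<exists>U. open U \<and> p \<in> U \<and> smooth_fun A U f)"

section \<open>Tangent vectors, fields and forms\<close>

type_synonym 'm tangent = "('m \<Rightarrow> real) \<Rightarrow> real"
type_synonym 'm vfield = "'m \<Rightarrow> 'm tangent"
type_synonym 'm oneform = "'m \<Rightarrow> 'm tangent \<Rightarrow> real"

(* Derivations at p of the algebra of germs of smooth functions.  The value 0 on functions that are
   not smooth near p is a normalisation making equality of HOL functions equality of derivations. *)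
definition tangent_space :: "('m::topological_space, 'n::finite) atlas \<Rightarrow> 'm \<Rightarrow> 'm tangent set" where
  "tangent_space A p = {v.
     (\<forall>f. \<not> smooth_near A p f \<longrightarrow> v f = 0) \<and>
     (\<forall>f g. smooth_near A p f \<and> (\<forall>\<^sub>F q in nhds p. f q = g q) \<longrightarrow> v f = v g) \<and>
     (\<forall>f g. smooth_near A p f \<and> smooth_near A p g \<longrightarrow> v (\<lambda>q. f q + g q) = v f + v g) \<and>
     (\<forall>c f. smooth_near A p f \<longrightarrow> v (\<lambda>q. c * f q) = c * v f) \<and>
     (\<forall>f g. smooth_near A p f \<and> smooth_near A p g \<longrightarrow>
        v (\<lambda>q. f q * g q) = v f * g p + f p * v g)}"

(* As above, covectors are normalised to vanish off the tangent space. *)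
definition cotangent_space ::
    "('m::topological_space, 'n::finite) atlas \<Rightarrow> 'm \<Rightarrow> ('m tangent \<Rightarrow> real) set" where
  "cotangent_space A p = {\<alpha>.
     (\<forall>v. v \<notin> tangent_space A p \<longrightarrow> \<alpha> v = 0) \<and>
     (\<forall>v\<in>tangent_space A p. \<forall>w\<in>tangent_space A p. \<alpha> (\<lambda>f. v f + w f) = \<alpha> v + \<alpha> w) \<and>
     (\<forall>c. \<forall>v\<in>tangent_space A p. \<alpha> (\<lambda>f. c * v f) = c * \<alpha> v)}"

definition vector_field :: "('m::topological_space, 'n::finite) atlas \<Rightarrow> 'm set \<Rightarrow> 'm vfield \<Rightarrow> bool" where
  "vector_field A U X \<longleftrightarrow>
     (\<forall>p\<in>U. X p \<in> tangent_space A p) \<and>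
     (\<forall>V f. open V \<and> V \<subseteq> U \<and> smooth_fun A V f \<longrightarrow> smooth_fun A V (\<lambda>p. X p f))"

definition one_form :: "('m::topological_space, 'n::finite) atlas \<Rightarrow> 'm set \<Rightarrow> 'm oneform \<Rightarrow> bool" where
  "one_form A U \<alpha> \<longleftrightarrow>
     (\<forall>p\<in>U. \<alpha> p \<in> cotangent_space A p) \<and>
     (\<forall>V X. open V \<and> V \<subseteq> U \<and> vector_field A V X \<longrightarrow> smooth_fun A V (\<lambda>p. \<alpha> p (X p)))"

(* Symmetric tensor fields with two upper indices, as symmetric bilinear forms on covectors. *)
definition sym_bivector_field ::
    "('m::topological_space, 'n::finite) atlas \<Rightarrow> 'm set
      \<Rightarrow> ('m \<Rightarrow> ('m tangent \<Rightarrow> real) \<Rightarrow> ('m tangent \<Rightarrow> real) \<Rightarrow> real) \<Rightarrow> bool" where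
  "sym_bivector_field A U g \<longleftrightarrow>
     (\<forall>p\<in>U. \<forall>\<alpha>\<in>cotangent_space A p. \<forall>\<beta>\<in>cotangent_space A p.
        g p \<alpha> \<beta> = g p \<beta> \<alpha> \<and>
        (\<forall>\<gamma>\<in>cotangent_space A p. g p \<alpha> (\<lambda>v. \<beta> v + \<gamma> v) = g p \<alpha> \<beta> + g p \<alpha> \<gamma>) \<and>
        (\<forall>c. g p \<alpha> (\<lambda>v. c * \<beta> v) = c * g p \<alpha> \<beta>)) \<and>
     (\<forall>V \<alpha> \<beta>. open V \<and> V \<subseteq> U \<and> one_form A V \<alpha> \<and> one_form A V \<beta> \<longrightarrow>
        smooth_fun A V (\<lambda>p. g p (\<alpha> p) (\<beta> p)))"

definition lie_bracket ::
    "('m::topological_space, 'n::finite) atlas \<Rightarrow> 'm vfield \<Rightarrow> 'm vfield \<Rightarrow> 'm vfield" where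
  "lie_bracket A X Y p f =
     (if smooth_near A p f then X p (\<lambda>q. Y q f) - Y p (\<lambda>q. X q f) else 0)"

definition wedge :: "'m oneform \<Rightarrow> 'm oneform \<Rightarrow> 'm vfield \<Rightarrow> 'm vfield \<Rightarrow> 'm \<Rightarrow> real" where
  "wedge \<alpha> \<beta> Y Z p = \<alpha> p (Y p) * \<beta> p (Z p) - \<alpha> p (Z p) * \<beta> p (Y p)"

definition ext_deriv ::
    "('m::topological_space, 'n::finite) atlas \<Rightarrow> 'm oneform \<Rightarrow> 'm vfield \<Rightarrow> 'm vfield \<Rightarrow> 'm \<Rightarrow> real" where
  "ext_deriv A \<alpha> Y Z p =
     Y p (\<lambda>q. \<alpha> q (Z q)) - Z p (\<lambda>q. \<alpha> q (Y q)) - \<alpha> p (lie_bracket A Y Z p)"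

section \<open>Connections and local frames\<close>

(* A connection acts on vector fields over arbitrary open sets and is compatible with restriction;
   the fields are total functions, whose values outside the open set in question are irrelevant. *)
definition affine_connection ::
    "('m::topological_space, 'n::finite) atlas \<Rightarrow> ('m vfield \<Rightarrow> 'm vfield \<Rightarrow> 'm vfield) \<Rightarrow> bool" where
  "affine_connection A N \<longleftrightarrow>
     (\<forall>U X Y. open U \<and> vector_field A U X \<and> vector_field A U Y \<longrightarrow>
        vector_field A U (N X Y) \<and>
        (\<forall>X' Y'. (\<forall>p\<in>U. X' p = X p \<and> Y' p = Y p) \<longrightarrow> (\<forall>p\<in>U. N X' Y' p = N X Y p)) \<and>
        (\<forall>Z. vector_field A U Z \<longrightarrow>
           (\<forall>p\<in>U. N (\<lambda>q f. X q f + Z q f) Y p = (\<lambda>f. N X Y p f + N Z Y p f)) \<and>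
           (\<forall>p\<in>U. N X (\<lambda>q f. Y q f + Z q f) p = (\<lambda>f. N X Y p f + N X Z p f))) \<and>
        (\<forall>h. smooth_fun A U h \<longrightarrow>
           (\<forall>p\<in>U. N (\<lambda>q f. h q * X q f) Y p = (\<lambda>f. h p * N X Y p f)) \<and>
           (\<forall>p\<in>U. N X (\<lambda>q f. h q * Y q f) p = (\<lambda>f. X p h * Y p f + h p * N X Y p f))))"

definition torsion_free ::
    "('m::topological_space, 'n::finite) atlas \<Rightarrow> ('m vfield \<Rightarrow> 'm vfield \<Rightarrow> 'm vfield) \<Rightarrow> bool" where
  "torsion_free A N \<longleftrightarrow>
     (\<forall>U X Y. open U \<and> vector_field A U X \<and> vector_field A U Y \<longrightarrow>
        (\<forall>p\<in>U. (\<lambda>f. N X Y p f - N Y X p f) = lie_bracket A X Y p))"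

definition local_frame ::
    "('m::topological_space, 'n::finite) atlas \<Rightarrow> 'm set \<Rightarrow> ('n \<Rightarrow> 'm vfield) \<Rightarrow> ('n \<Rightarrow> 'm oneform) \<Rightarrow> bool" where
  "local_frame A U X \<theta> \<longleftrightarrow>
     open U \<and> (\<forall>a. vector_field A U (X a)) \<and> (\<forall>a. one_form A U (\<theta> a)) \<and>
     (\<forall>p\<in>U. \<forall>a b. \<theta> a p (X b p) = (if a = b then 1 else 0)) \<and>
     (\<forall>p\<in>U. \<forall>v\<in>tangent_space A p. v = (\<lambda>f. \<Sum>a\<in>UNIV. \<theta> a p v * X a p f))"

section \<open>Tensor calculus in a frame\<close>

context
  fixes A :: "('m::topological_space, 'n::finite) atlas"
    and N :: "'m vfield \<Rightarrow> 'm vfield \<Rightarrow> 'm vfield"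
    and X :: "'n \<Rightarrow> 'm vfield"
    and \<theta> :: "'n \<Rightarrow> 'm oneform"
begin

(* conn_coeff a b c is Gamma^a_bc; the last index is the direction of differentiation. *)
definition conn_coeff :: "'n \<Rightarrow> 'n \<Rightarrow> 'n \<Rightarrow> 'm \<Rightarrow> real" where
  "conn_coeff a b c p = \<theta> a p (N (X c) (X b) p)"

definition conn_form :: "'n \<Rightarrow> 'n \<Rightarrow> 'm oneform" where
  "conn_form a b p v = (\<Sum>c\<in>UNIV. conn_coeff a b c p * \<theta> c p v)"

(* Components K as bs of tensor-valued forms carry a list as of upper and a list bs of lower frame
   indices.  cov_D is D on tensor-valued functions, cov_D1 is D on tensor-valued 1-forms. *)
definition cov_D :: "('n list \<Rightarrow> 'n list \<Rightarrow> 'm \<Rightarrow> real) \<Rightarrow> 'n list \<Rightarrow> 'n list \<Rightarrow> 'm oneform" where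
  "cov_D K as bs p v = v (K as bs)
     + (\<Sum>i<length as. \<Sum>e\<in>UNIV. conn_form (as ! i) e p v * K (as[i := e]) bs p)
     - (\<Sum>j<length bs. \<Sum>e\<in>UNIV. conn_form e (bs ! j) p v * K as (bs[j := e]) p)"

definition cov_D1 ::
    "('n list \<Rightarrow> 'n list \<Rightarrow> 'm oneform) \<Rightarrow> 'n list \<Rightarrow> 'n list \<Rightarrow> 'm vfield \<Rightarrow> 'm vfield \<Rightarrow> 'm \<Rightarrow> real" where
  "cov_D1 K as bs Y Z p = ext_deriv A (K as bs) Y Z p
     + (\<Sum>i<length as. \<Sum>e\<in>UNIV. wedge (conn_form (as ! i) e) (K (as[i := e]) bs) Y Z p)
     - (\<Sum>j<length bs. \<Sum>e\<in>UNIV. wedge (conn_form e (bs ! j)) (K as (bs[j := e])) Y Z p)"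

definition nabla :: "'n \<Rightarrow> ('n list \<Rightarrow> 'n list \<Rightarrow> 'm \<Rightarrow> real) \<Rightarrow> 'n list \<Rightarrow> 'n list \<Rightarrow> 'm \<Rightarrow> real" where
  "nabla c K as bs p = cov_D K as bs p (X c p)"

definition curv_form :: "'n \<Rightarrow> 'n \<Rightarrow> 'm vfield \<Rightarrow> 'm vfield \<Rightarrow> 'm \<Rightarrow> real" where
  "curv_form a b Y Z p =
     ext_deriv A (conn_form a b) Y Z p + (\<Sum>c\<in>UNIV. wedge (conn_form a c) (conn_form c b) Y Z p)"

(* The components R^a_bcd of the 2-form Omega^a_b = 1/2 R^a_bcd theta^c wedge theta^d. *)
definition riemann :: "'n \<Rightarrow> 'n \<Rightarrow> 'n \<Rightarrow> 'n \<Rightarrow> 'm \<Rightarrow> real" where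
  "riemann a b c d p = curv_form a b (X c) (X d) p"

definition ricci :: "'n \<Rightarrow> 'n \<Rightarrow> 'm \<Rightarrow> real" where
  "ricci a b p = (\<Sum>c\<in>UNIV. riemann c a c b p)"

definition schouten :: "'n \<Rightarrow> 'n \<Rightarrow> 'm \<Rightarrow> real" where
  "schouten a b p =
     1 / (real CARD('n) - 1) * ((ricci a b p + ricci b a p) / 2)
     - 1 / (real CARD('n) + 1) * ((ricci a b p - ricci b a p) / 2)"

definition omega :: "'n \<Rightarrow> 'm oneform" where
  "omega b p v = (\<Sum>a\<in>UNIV. \<theta> a p v * schouten a b p)"

definition weyl :: "'n \<Rightarrow> 'n \<Rightarrow> 'n \<Rightarrow> 'n \<Rightarrow> 'm \<Rightarrow> real" where
  "weyl a b c d p = riemann a b c d p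
     - (if a = c then 1 else 0) * schouten d b p
     + (if a = d then 1 else 0) * schouten c b p
     + 2 * (if a = b then 1 else 0) * ((schouten c d p - schouten d c p) / 2)"

(* cotton b c a is Y_bca; the first two indices are the antisymmetric pair. *)
definition cotton :: "'n \<Rightarrow> 'n \<Rightarrow> 'n \<Rightarrow> 'm \<Rightarrow> real" where
  "cotton b c a p =
     2 * ((nabla b (\<lambda>_ is. schouten (is ! 0) (is ! 1)) [] [c, a] p
         - nabla c (\<lambda>_ is. schouten (is ! 0) (is ! 1)) [] [b, a] p) / 2)"

(* nabla_cotton a b c d is nabla_a Y_bcd. *)
definition nabla_cotton :: "'n \<Rightarrow> 'n \<Rightarrow> 'n \<Rightarrow> 'n \<Rightarrow> 'm \<Rightarrow> real" where
  "nabla_cotton a b c d p =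
     nabla a (\<lambda>_ is. cotton (is ! 0) (is ! 1) (is ! 2)) [] [b, c, d] p"

(* U_[ab]cd *)
definition U_tensor :: "'n \<Rightarrow> 'n \<Rightarrow> 'n \<Rightarrow> 'n \<Rightarrow> 'm \<Rightarrow> real" where
  "U_tensor a b c d p =
     ((nabla_cotton a b c d p + nabla_cotton a b d c p) / 2
      - (nabla_cotton b a c d p + nabla_cotton b a d c p) / 2) / 2
     + (\<Sum>e\<in>UNIV.
         ((weyl e c d a p + weyl e d c a p) / 2 * schouten b e p
          - (weyl e c d b p + weyl e d c b p) / 2 * schouten a e p) / 2)"

definition vec_comp :: "'m vfield \<Rightarrow> 'n \<Rightarrow> 'm \<Rightarrow> real" where
  "vec_comp \<mu> b p = \<theta> b p (\<mu> p)"

definition bivec_comp ::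
    "('m \<Rightarrow> ('m tangent \<Rightarrow> real) \<Rightarrow> ('m tangent \<Rightarrow> real) \<Rightarrow> real) \<Rightarrow> 'n \<Rightarrow> 'n \<Rightarrow> 'm \<Rightarrow> real" where
  "bivec_comp g b c p = g p (\<theta> b p) (\<theta> c p)"

end

definition oneform_eq_on ::
    "('m::topological_space, 'n::finite) atlas \<Rightarrow> 'm set \<Rightarrow> 'm oneform \<Rightarrow> 'm oneform \<Rightarrow> bool" where
  "oneform_eq_on A U \<alpha> \<beta> \<longleftrightarrow> (\<forall>p\<in>U. \<forall>v\<in>tangent_space A p. \<alpha> p v = \<beta> p v)"

end

theory Submission
  imports Defs
begin

text \<open>
  Write \<open>\<sigma>\<^sub>a = -2 P\<^sub>a\<^sub>c \<mu>\<^sup>c + (2/n) Y\<^sub>a\<^sub>b\<^sub>c g\<^sup>b\<^sup>c\<close> for the components of the prescribed value of \<open>D\<rho>\<close>. Without torsion,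
  its exterior derivative has the components \<open>\<nabla>\<^sub>a \<sigma>\<^sub>b - \<nabla>\<^sub>b \<sigma>\<^sub>a\<close>. Expand this by the Leibniz rule and
  substitute the equations for \<open>Dg\<close> and \<open>D\<mu>\<close>: the terms in \<open>\<rho>\<close> and the terms quadratic in \<open>P\<close> cancel
  because \<open>P\<close> and \<open>g\<close> are symmetric, the derivatives of \<open>Y\<close> and the Weyl terms combine to
  \<open>(4/n) U\<^sub>a\<^sub>b\<^sub>c\<^sub>d g\<^sup>c\<^sup>d\<close>, and the cyclic identity for \<open>Y\<close> (again from the symmetry of \<open>P\<close>) collects the
  remaining terms into \<open>(2(n+3)/n) Y\<^sub>b\<^sub>a\<^sub>c \<mu>\<^sup>c\<close>.
\<close>

section \<open>Smooth functions and tangent vectors\<close>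

text \<open>On an open set, equal functions agree near every point and so have the same Frechet
  derivative there; this carries the hypothesis down the recursion on \<open>k\<close>.\<close>

lemma Ck_on_cong:
  assumes "open S" "Ck_on k f S" "\<And>x. x \<in> S \<Longrightarrow> f x = g x"
  shows "Ck_on k g S"
  using assms(2,3)
proof (induction k arbitrary: f g)
  case 0
  then show ?case by (simp cong: continuous_on_cong)
next
  case (Suc k)
  have der: "(g has_derivative frechet_derivative f (at x)) (at x)" if "x \<in> S" for x
  proof (rule has_derivative_transform_within_open[OF _ \<open>open S\<close> that])
    show "(f has_derivative frechet_derivative f (at x)) (at x)"
      using Suc.prems(1) that by (simp flip: frechet_derivative_works)
  qed (rule Suc.prems(2))
  show ?case
    unfolding Ck_on.simps
  proof (intro conjI ballI allI)
    fix v
    have "Ck_on k (\<lambda>x. frechet_derivative f (at x) v) S"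
      using Suc.prems by simp
    then show "Ck_on k (\<lambda>x. frechet_derivative g (at x) v) S"
      by (rule Suc.IH) (simp flip: frechet_derivative_at[OF der])
  qed (use der in \<open>auto simp: differentiable_def\<close>)
qed

text \<open>The recursion puts the order on the derivatives and not on \<open>f\<close>, so lowering
  it takes an induction, which starts from the continuity of differentiable functions.\<close>

lemma Ck_on_SucD: "Ck_on (Suc k) f S \<Longrightarrow> Ck_on k f S"
proof (induction k arbitrary: f)
  case 0
  then show ?case
    by (auto intro!: continuous_at_imp_continuous_on differentiable_imp_continuous_within)
next
  case (Suc k)
  \<comment> \<open>The instance of the recursion equation opens the outer layer alone and leaves
    the order \<open>Suc k\<close> of the derivatives intact for the induction hypothesis.\<close>
  have "f differentiable (at x)" if "x \<in> S" for x
    using Suc.prems that unfolding Ck_on.simps(2)[of "Suc k"] by blast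
  moreover have "Ck_on k (\<lambda>x. frechet_derivative f (at x) v) S" for v
    using Suc.prems Suc.IH unfolding Ck_on.simps(2)[of "Suc k"] by blast
  ultimately show ?case by simp
qed

lemma Ck_on_const: "open S \<Longrightarrow> Ck_on k (\<lambda>_. c) S"
proof (induction k arbitrary: c)
  case (Suc k)
  then show ?case by simp
qed simp

lemma Ck_on_add:
  assumes "open S" "Ck_on k f S" "Ck_on k g S"
  shows "Ck_on k (\<lambda>x. f x + g x) S"
  using assms(2,3)
proof (induction k arbitrary: f g)
  case 0
  then show ?case by (simp add: continuous_on_add)
next
  case (Suc k)
  have der: "((\<lambda>x. f x + g x) has_derivative
      (\<lambda>v. frechet_derivative f (at x) v + frechet_derivative g (at x) v)) (at x)" if "x \<in> S" for x
    using Suc.prems that by (auto intro!: has_derivative_add simp: frechet_derivative_works[symmetric])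
  show ?case
    unfolding Ck_on.simps
  proof (intro conjI ballI allI)
    fix v
    have "Ck_on k (\<lambda>x. frechet_derivative f (at x) v + frechet_derivative g (at x) v) S"
      using Suc.prems by (intro Suc.IH) auto
    then show "Ck_on k (\<lambda>x. frechet_derivative (\<lambda>x. f x + g x) (at x) v) S"
      by (rule Ck_on_cong[OF \<open>open S\<close>]) (simp flip: frechet_derivative_at[OF der])
  qed (use der in \<open>auto simp: differentiable_def\<close>)
qed

lemma Ck_on_mult:
  fixes f g :: "'a::real_normed_vector \<Rightarrow> real"
  assumes "open S" "Ck_on k f S" "Ck_on k g S"
  shows "Ck_on k (\<lambda>x. f x * g x) S"
  using assms(2,3)
proof (induction k arbitrary: f g)
  case 0
  then show ?case by (simp add: continuous_on_mult)
next
  case (Suc k)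
  have der: "((\<lambda>x. f x * g x) has_derivative
      (\<lambda>v. f x * frechet_derivative g (at x) v + frechet_derivative f (at x) v * g x)) (at x)"
    if "x \<in> S" for x
    using Suc.prems that by (auto intro!: has_derivative_mult simp: frechet_derivative_works[symmetric])
  show ?case
    unfolding Ck_on.simps
  proof (intro conjI ballI allI)
    fix v
    have "Ck_on k (\<lambda>x. f x * frechet_derivative g (at x) v + frechet_derivative f (at x) v * g x) S"
      \<comment> \<open>The product rule contains \<open>f\<close> and \<open>g\<close>
        undifferentiated, so both must be available at order \<open>k\<close>.\<close>
      using Suc.prems Suc.prems[THEN Ck_on_SucD]
      by (intro Ck_on_add[OF \<open>open S\<close>] Suc.IH) auto
    then show "Ck_on k (\<lambda>x. frechet_derivative (\<lambda>x. f x * g x) (at x) v) S"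
      by (rule Ck_on_cong[OF \<open>open S\<close>]) (simp flip: frechet_derivative_at[OF der])
  qed (use der in \<open>auto simp: differentiable_def\<close>)
qed

section \<open>Smooth functions on a manifold, through charts\<close>

lemma open_chart_image:
  assumes "smooth_manifold A" "(V, \<phi>) \<in> A" "open U"
  shows "open (\<phi> ` (V \<inter> U))"
proof -
  have V: "open V" "open (\<phi> ` V)" "homeomorphism V (\<phi> ` V) \<phi> (inv_into V \<phi>)"
    using assms(1,2) by (auto simp: smooth_manifold_def)
  then have "openin (top_of_set (\<phi> ` V)) (\<phi> ` (V \<inter> U))"
    using assms(3) by (intro homeomorphism_imp_open_map[OF V(3)]) auto
  then show ?thesis
    using V(2) openin_open_eq by blast
qed

lemma smooth_fun_const: "smooth_manifold A \<Longrightarrow> open U \<Longrightarrow> smooth_fun A U (\<lambda>_. c)"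
  by (auto simp: smooth_fun_def smooth_on_def o_def intro!: Ck_on_const open_chart_image)

lemma smooth_fun_add:
  assumes "smooth_manifold A" "open U" "smooth_fun A U f" "smooth_fun A U g"
  shows "smooth_fun A U (\<lambda>p. f p + g p)"
  unfolding smooth_fun_def smooth_on_def
proof clarify
  fix V \<phi> k
  assume V: "(V, \<phi>) \<in> A"
  have "Ck_on k (f \<circ> inv_into V \<phi>) (\<phi> ` (V \<inter> U))" "Ck_on k (g \<circ> inv_into V \<phi>) (\<phi> ` (V \<inter> U))"
    using assms(3,4) V unfolding smooth_fun_def smooth_on_def by blast+
  from Ck_on_add[OF open_chart_image[OF assms(1) V assms(2)] this]
  show "Ck_on k ((\<lambda>p. f p + g p) \<circ> inv_into V \<phi>) (\<phi> ` (V \<inter> U))"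
    by (simp add: o_def)
qed

lemma smooth_fun_mult:
  assumes "smooth_manifold A" "open U" "smooth_fun A U f" "smooth_fun A U g"
  shows "smooth_fun A U (\<lambda>p. f p * g p)"
  unfolding smooth_fun_def smooth_on_def
proof clarify
  fix V \<phi> k
  assume V: "(V, \<phi>) \<in> A"
  have "Ck_on k (f \<circ> inv_into V \<phi>) (\<phi> ` (V \<inter> U))" "Ck_on k (g \<circ> inv_into V \<phi>) (\<phi> ` (V \<inter> U))"
    using assms(3,4) V unfolding smooth_fun_def smooth_on_def by blast+
  from Ck_on_mult[OF open_chart_image[OF assms(1) V assms(2)] this]
  show "Ck_on k ((\<lambda>p. f p * g p) \<circ> inv_into V \<phi>) (\<phi> ` (V \<inter> U))"
    by (simp add: o_def)
qed

lemma smooth_fun_cong: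
  assumes "smooth_manifold A" "open U" "smooth_fun A U f" "\<And>p. p \<in> U \<Longrightarrow> f p = g p"
  shows "smooth_fun A U g"
  unfolding smooth_fun_def smooth_on_def
proof clarify
  fix V \<phi> k
  assume V: "(V, \<phi>) \<in> A"
  show "Ck_on k (g \<circ> inv_into V \<phi>) (\<phi> ` (V \<inter> U))"
  proof (rule Ck_on_cong)
    show "open (\<phi> ` (V \<inter> U))"
      by (rule open_chart_image[OF assms(1) V assms(2)])
    show "Ck_on k (f \<circ> inv_into V \<phi>) (\<phi> ` (V \<inter> U))"
      using assms(3) V by (auto simp: smooth_fun_def smooth_on_def)
    \<comment> \<open>The inverse chart undoes the chart, so on the image of
      \<open>V \<inter> U\<close> both compositions are evaluated at points of
      \<open>U\<close>.\<close>
    have "homeomorphism V (\<phi> ` V) \<phi> (inv_into V \<phi>)"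
      using assms(1) V by (auto simp: smooth_manifold_def)
    then show "(f \<circ> inv_into V \<phi>) x = (g \<circ> inv_into V \<phi>) x" if "x \<in> \<phi> ` (V \<inter> U)" for x
      using that assms(4) by (auto simp: homeomorphism_def)
  qed
qed

lemma smooth_fun_imp_near: "open U \<Longrightarrow> p \<in> U \<Longrightarrow> smooth_fun A U f \<Longrightarrow> smooth_near A p f"
  by (auto simp: smooth_near_def)

section \<open>Derivations and covectors at a point\<close>

lemma tangent_space_rules:
  assumes "v \<in> tangent_space A p"
  shows tangent_space_junk: "\<not> smooth_near A p f \<Longrightarrow> v f = 0"
    and tangent_space_local: "smooth_near A p f \<Longrightarrow> \<forall>\<^sub>F q in nhds p. f q = g q \<Longrightarrow> v f = v g"
    and tangent_space_add:
      "smooth_near A p f \<Longrightarrow> smooth_near A p g \<Longrightarrow> v (\<lambda>q. f q + g q) = v f + v g"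
    and tangent_space_scale: "smooth_near A p f \<Longrightarrow> v (\<lambda>q. c * f q) = c * v f"
    and tangent_space_mult:
      "smooth_near A p f \<Longrightarrow> smooth_near A p g \<Longrightarrow> v (\<lambda>q. f q * g q) = v f * g p + f p * v g"
proof -
  note v = assms[unfolded tangent_space_def mem_Collect_eq]
  show "\<not> smooth_near A p f \<Longrightarrow> v f = 0"
    by (rule v[THEN conjunct1, rule_format])
  show "smooth_near A p f \<Longrightarrow> \<forall>\<^sub>F q in nhds p. f q = g q \<Longrightarrow> v f = v g"
    by (rule v[THEN conjunct2, THEN conjunct1, rule_format], rule conjI)
  show "smooth_near A p f \<Longrightarrow> smooth_near A p g \<Longrightarrow> v (\<lambda>q. f q + g q) = v f + v g"
    by (rule v[THEN conjunct2, THEN conjunct2, THEN conjunct1, rule_format], rule conjI)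
  show "smooth_near A p f \<Longrightarrow> v (\<lambda>q. c * f q) = c * v f"
    by (rule v[THEN conjunct2, THEN conjunct2, THEN conjunct2, THEN conjunct1, rule_format])
  show "smooth_near A p f \<Longrightarrow> smooth_near A p g \<Longrightarrow> v (\<lambda>q. f q * g q) = v f * g p + f p * v g"
    by (rule v[THEN conjunct2, THEN conjunct2, THEN conjunct2, THEN conjunct2, rule_format], rule conjI)
qed

text \<open>The normalisation survives too: at functions not smooth near \<open>p\<close> both terms
  are 0. This makes the difference of two covariant derivatives, hence a Lie bracket, an admissible
  argument of a covector.\<close>

lemma tangent_space_diff:
  assumes v: "v \<in> tangent_space A p" and w: "w \<in> tangent_space A p"
  shows "(\<lambda>f. v f - w f) \<in> tangent_space A p"
  unfolding tangent_space_def mem_Collect_eq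
proof (intro conjI allI impI)
  fix f g
  assume "smooth_near A p f \<and> (\<forall>\<^sub>F q in nhds p. f q = g q)"
  then show "v f - w f = v g - w g"
    using tangent_space_local[OF v, of f g] tangent_space_local[OF w, of f g] by simp
qed (simp_all add: v w tangent_space_junk[of _ A p] tangent_space_add[of _ A p]
      tangent_space_scale[of _ A p] tangent_space_mult[of _ A p] algebra_simps)

text \<open>Additivity applied to v = (v - w) + w. It is postulated on tangent vectors, hence the
  appeal to \<open>tangent_space_diff\<close>.\<close>

lemma cotangent_diff:
  assumes "\<alpha> \<in> cotangent_space A p" "v \<in> tangent_space A p" "w \<in> tangent_space A p"
  shows "\<alpha> (\<lambda>f. v f - w f) = \<alpha> v - \<alpha> w"
proof -
  have "\<alpha> (\<lambda>f. (v f - w f) + w f) = \<alpha> (\<lambda>f. v f - w f) + \<alpha> w"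
    using assms(1) tangent_space_diff[OF assms(2,3)] assms(3)
    unfolding cotangent_space_def mem_Collect_eq by (elim conjE) (drule bspec, assumption, drule bspec, assumption)
  then show ?thesis by simp
qed

section \<open>Tensor calculus in a local frame\<close>

text \<open>Renaming the summed indices turns the transposed term into the original one. This
  removes the symmetrization over c, d from U once it is contracted with g.\<close>

lemma sum_sym_contract:
  fixes t u :: "'i::finite \<Rightarrow> 'i \<Rightarrow> real"
  assumes "\<And>c d. u c d = u d c"
  shows "(\<Sum>c\<in>UNIV. \<Sum>d\<in>UNIV. (t c d + t d c) / 2 * u c d) = (\<Sum>c\<in>UNIV. \<Sum>d\<in>UNIV. t c d * u c d)"
proof -
  have "(\<Sum>c\<in>UNIV. \<Sum>d\<in>UNIV. t d c * u c d) = (\<Sum>c\<in>UNIV. \<Sum>d\<in>UNIV. t c d * u c d)"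
    by (subst sum.swap) (simp add: assms)
  then show ?thesis
    by (simp add: distrib_right add_divide_distrib sum.distrib flip: sum_divide_distrib)
qed

section \<open>Smooth functions and derivatives along a frame\<close>

locale framed_connection =
  fixes A :: "('m::{t2_space,second_countable_topology}, 'n::finite) atlas"
    and N :: "'m vfield \<Rightarrow> 'm vfield \<Rightarrow> 'm vfield"
    and U :: "'m set"
    and X :: "'n \<Rightarrow> 'm vfield"
    and \<theta> :: "'n \<Rightarrow> 'm oneform"
  assumes manifold: "smooth_manifold A"
    and connection: "affine_connection A N"
    and torsion: "torsion_free A N"
    and frame: "local_frame A U X \<theta>"
begin

abbreviation smooth :: "('m \<Rightarrow> real) \<Rightarrow> bool" where
  "smooth \<equiv> smooth_fun A U"

abbreviation Gam :: "'n \<Rightarrow> 'n \<Rightarrow> 'n \<Rightarrow> 'm \<Rightarrow> real" ("\<Gamma>") where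
  "\<Gamma> \<equiv> conn_coeff N X \<theta>"

text \<open>\<open>nabla\<close> expects components indexed by lists. The wrapping of curried
  components is the one found in \<open>cotton\<close> and \<open>nabla_cotton\<close>, so those
  unfold directly to \<open>nab2\<close> and \<open>nab3\<close>.\<close>

abbreviation nab2 :: "'n \<Rightarrow> ('n \<Rightarrow> 'n \<Rightarrow> 'm \<Rightarrow> real) \<Rightarrow> 'n \<Rightarrow> 'n \<Rightarrow> 'm \<Rightarrow> real" where
  "nab2 a T b c \<equiv> nabla N X \<theta> a (\<lambda>_ is. T (is ! 0) (is ! 1)) [] [b, c]"

abbreviation nab3 :: "'n \<Rightarrow> ('n \<Rightarrow> 'n \<Rightarrow> 'n \<Rightarrow> 'm \<Rightarrow> real) \<Rightarrow> 'n \<Rightarrow> 'n \<Rightarrow> 'n \<Rightarrow> 'm \<Rightarrow> real" where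
  "nab3 a T b c d \<equiv> nabla N X \<theta> a (\<lambda>_ is. T (is ! 0) (is ! 1) (is ! 2)) [] [b, c, d]"

lemma open_U: "open U"
  and X_field: "vector_field A U (X a)"
  and theta_form: "one_form A U (\<theta> a)"
  and dual: "p \<in> U \<Longrightarrow> \<theta> a p (X b p) = (if a = b then 1 else 0)"
  using frame by (auto simp: local_frame_def)

lemma X_tangent: "p \<in> U \<Longrightarrow> X a p \<in> tangent_space A p"
  and theta_cotangent: "p \<in> U \<Longrightarrow> \<theta> a p \<in> cotangent_space A p"
  using X_field theta_form by (auto simp: vector_field_def one_form_def)

lemma smooth_near: "p \<in> U \<Longrightarrow> smooth f \<Longrightarrow> smooth_near A p f"
  by (rule smooth_fun_imp_near[OF open_U])

named_theorems smooth_intros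

lemma smooth_const [smooth_intros]: "smooth (\<lambda>_. c)"
  by (rule smooth_fun_const[OF manifold open_U])

lemma smooth_add [smooth_intros]: "smooth f \<Longrightarrow> smooth g \<Longrightarrow> smooth (\<lambda>p. f p + g p)"
  by (rule smooth_fun_add[OF manifold open_U])

lemma smooth_mult [smooth_intros]: "smooth f \<Longrightarrow> smooth g \<Longrightarrow> smooth (\<lambda>p. f p * g p)"
  by (rule smooth_fun_mult[OF manifold open_U])

lemma smooth_cong: "smooth f \<Longrightarrow> (\<And>p. p \<in> U \<Longrightarrow> f p = g p) \<Longrightarrow> smooth g"
  by (rule smooth_fun_cong[OF manifold open_U])

lemma smooth_diff [smooth_intros]: "smooth f \<Longrightarrow> smooth g \<Longrightarrow> smooth (\<lambda>p. f p - g p)"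
  using smooth_add[of f "\<lambda>p. - 1 * g p"] smooth_mult[OF smooth_const[of "- 1"], of g] by simp

lemma smooth_divide [smooth_intros]: "smooth f \<Longrightarrow> smooth (\<lambda>p. f p / c)"
  using smooth_mult[of f "\<lambda>_. 1 / c"] smooth_const by simp

lemma smooth_sum [smooth_intros]: "(\<And>i. smooth (f i)) \<Longrightarrow> smooth (\<lambda>p. \<Sum>i\<in>I. f i p)"
  by (induction I rule: infinite_finite_induct) (simp_all add: smooth_intros)

lemma smooth_X [smooth_intros]: "smooth f \<Longrightarrow> smooth (\<lambda>p. X a p f)"
  using X_field open_U unfolding vector_field_def by blast

text \<open>A derivation sees only the germ at \<open>p\<close>, and \<open>U\<close> is a
  neighbourhood of \<open>p\<close>. Thus component formulas known only on \<open>U\<close> may be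
  differentiated.\<close>

lemma X_cong:
  assumes "p \<in> U" "smooth f" "\<And>q. q \<in> U \<Longrightarrow> f q = g q"
  shows "X a p f = X a p g"
proof (rule tangent_space_local[OF X_tangent])
  show "\<forall>\<^sub>F q in nhds p. f q = g q"
    using assms open_U eventually_nhds by blast
qed (use assms smooth_near in auto)

lemma X_add: "p \<in> U \<Longrightarrow> smooth f \<Longrightarrow> smooth g \<Longrightarrow> X a p (\<lambda>q. f q + g q) = X a p f + X a p g"
  by (intro tangent_space_add[OF X_tangent] smooth_near)

lemma X_mult:
  "p \<in> U \<Longrightarrow> smooth f \<Longrightarrow> smooth g \<Longrightarrow> X a p (\<lambda>q. f q * g q) = X a p f * g p + f p * X a p g"
  by (intro tangent_space_mult[OF X_tangent] smooth_near)

lemma X_scale: "p \<in> U \<Longrightarrow> smooth f \<Longrightarrow> X a p (\<lambda>q. c * f q) = c * X a p f"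
  by (intro tangent_space_scale[OF X_tangent] smooth_near)

lemma X_sum:
  assumes "p \<in> U" "\<And>i. smooth (f i)"
  shows "X a p (\<lambda>q. \<Sum>i\<in>I. f i q) = (\<Sum>i\<in>I. X a p (f i))"
proof (induction I rule: infinite_finite_induct)
  case (insert i I)
  then show ?case
    using assms X_add[of p "f i" "\<lambda>q. \<Sum>i\<in>I. f i q" a] by (simp add: smooth_sum)
\<comment> \<open>Empty and infinite sums are the constant 0, treated as 0 times a smooth
  constant.\<close>
qed (use X_scale[OF assms(1) smooth_const, of a 0] in simp_all)

section \<open>Connection coefficients, exterior derivative and curvature in components\<close>

lemma covariant_field: "vector_field A U (N (X a) (X b))"
  using connection open_U X_field unfolding affine_connection_def by blast

lemma smooth_conn [smooth_intros]: "smooth (\<Gamma> a b c)"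
proof -
  have "smooth (\<lambda>p. \<theta> a p (N (X c) (X b) p))"
    using theta_form open_U covariant_field unfolding one_form_def by blast
  then show ?thesis by (simp add: conn_coeff_def[abs_def])
qed

text \<open>Without torsion the bracket is the difference of the two covariant derivatives. The
  direction of differentiation is the last index of \<Gamma>, which explains the order of b and
  a.\<close>

lemma lie_bracket_frame:
  assumes "p \<in> U"
  shows "lie_bracket A (X a) (X b) p \<in> tangent_space A p"
    and "\<theta> e p (lie_bracket A (X a) (X b) p) = \<Gamma> e b a p - \<Gamma> e a b p"
proof -
  have eq: "lie_bracket A (X a) (X b) p = (\<lambda>f. N (X a) (X b) p f - N (X b) (X a) p f)"
    using torsion open_U X_field assms unfolding torsion_free_def by metis
  have tan: "N (X a) (X b) p \<in> tangent_space A p" for a b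
    using covariant_field assms by (auto simp: vector_field_def)
  show "lie_bracket A (X a) (X b) p \<in> tangent_space A p"
    unfolding eq by (intro tangent_space_diff tan)
  show "\<theta> e p (lie_bracket A (X a) (X b) p) = \<Gamma> e b a p - \<Gamma> e a b p"
    unfolding eq cotangent_diff[OF theta_cotangent[OF assms] tan tan] by (simp add: conn_coeff_def)
qed

text \<open>The right-hand side is \<nabla>_a s_b - \<nabla>_b s_a written out. Only the values of
  \<sigma> on tangent vectors over \<open>U\<close> are prescribed, so connection forms, D\<rho> and
  its prescribed value are all covered.\<close>

lemma ext_deriv_frame:
  assumes "p \<in> U" and s: "\<And>e. smooth (s e)"
    and \<sigma>: "\<And>q v. q \<in> U \<Longrightarrow> v \<in> tangent_space A q \<Longrightarrow> \<sigma> q v = (\<Sum>e\<in>UNIV. s e q * \<theta> e q v)"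
  shows "ext_deriv A \<sigma> (X a) (X b) p =
    X a p (s b) - X b p (s a) - (\<Sum>e\<in>UNIV. s e p * (\<Gamma> e b a p - \<Gamma> e a b p))"
proof -
  \<comment> \<open>By duality the coefficients are the values on the frame; locality then lets them
    be differentiated in place of \<sigma>(X_c).\<close>
  have "s c q = \<sigma> q (X c q)" if "q \<in> U" for c q
    using that by (simp add: \<sigma> X_tangent dual sum.delta if_distrib cong: if_cong)
  then have "X d p (\<lambda>q. \<sigma> q (X c q)) = X d p (s c)" for c d
    by (intro X_cong[OF assms(1) s, symmetric])
  then show ?thesis
    using assms(1) by (simp add: ext_deriv_def \<sigma> lie_bracket_frame)
qed

lemma conn_form_frame: "p \<in> U \<Longrightarrow> conn_form N X \<theta> a b p (X c p) = \<Gamma> a b c p"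
  by (simp add: conn_form_def dual sum.delta if_distrib cong: if_cong)

text \<open>A polynomial in the connection coefficients and their frame derivatives, from which
  smoothness passes to the curvature and on to the Schouten and Cotton tensors.\<close>

lemma riemann_frame:
  assumes "p \<in> U"
  shows "riemann A N X \<theta> a b c d p = X c p (\<Gamma> a b d) - X d p (\<Gamma> a b c)
    - (\<Sum>e\<in>UNIV. \<Gamma> a b e p * (\<Gamma> e d c p - \<Gamma> e c d p))
    + (\<Sum>e\<in>UNIV. \<Gamma> a e c p * \<Gamma> e b d p - \<Gamma> a e d p * \<Gamma> e b c p)"
proof -
  have "ext_deriv A (conn_form N X \<theta> a b) (X c) (X d) p = X c p (\<Gamma> a b d) - X d p (\<Gamma> a b c)
    - (\<Sum>e\<in>UNIV. \<Gamma> a b e p * (\<Gamma> e d c p - \<Gamma> e c d p))"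
    by (rule ext_deriv_frame[OF assms smooth_conn]) (simp add: conn_form_def)
  then show ?thesis
    using assms by (simp add: riemann_def curv_form_def wedge_def conn_form_frame)
qed

lemma smooth_riemann [smooth_intros]: "smooth (riemann A N X \<theta> a b c d)"
  by (rule smooth_cong[OF _ riemann_frame[symmetric]]) (intro smooth_intros)

lemma smooth_schouten [smooth_intros]: "smooth (schouten A N X \<theta> a b)"
  unfolding schouten_def[abs_def] ricci_def by (intro smooth_intros)

section \<open>Covariant derivatives and the symmetries of the Cotton tensor\<close>

lemma nabla2_frame:
  assumes "p \<in> U"
  shows "nab2 a T b c p =
    X a p (T b c) - (\<Sum>e\<in>UNIV. \<Gamma> e b a p * T e c p) - (\<Sum>e\<in>UNIV. \<Gamma> e c a p * T b e p)"
  using assms by (simp add: nabla_def cov_D_def conn_form_frame lessThan_Suc numeral_2_eq_2)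

lemma nabla3_frame:
  assumes "p \<in> U"
  shows "nab3 a T b c d p =
    X a p (T b c d) - (\<Sum>e\<in>UNIV. \<Gamma> e b a p * T e c d p) - (\<Sum>e\<in>UNIV. \<Gamma> e c a p * T b e d p)
      - (\<Sum>e\<in>UNIV. \<Gamma> e d a p * T b c e p)"
  using assms by (simp add: nabla_def cov_D_def conn_form_frame lessThan_Suc numeral_2_eq_2 numeral_3_eq_3)

lemma cotton_nabla: "cotton A N X \<theta> b c a p =
    nab2 b (schouten A N X \<theta>) c a p - nab2 c (schouten A N X \<theta>) b a p"
  by (simp add: cotton_def)

lemma smooth_cotton [smooth_intros]: "smooth (cotton A N X \<theta> a b c)"
proof -
  have "smooth (nab2 a (schouten A N X \<theta>) b c)" for a b c
    by (rule smooth_cong[OF _ nabla2_frame[symmetric]]) (intro smooth_intros)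
  then show ?thesis
    by (simp add: cotton_nabla[abs_def] smooth_diff)
qed

text \<open>Exchanging b and c exchanges the two connection terms. The derivative term needs the
  symmetry on all of \<open>U\<close>, through \<open>X_cong\<close>.\<close>

lemma nabla2_sym:
  assumes "p \<in> U" "\<And>b c. smooth (T b c)" "\<And>q b c. q \<in> U \<Longrightarrow> T b c q = T c b q"
  shows "nab2 a T b c p = nab2 a T c b p"
  unfolding nabla2_frame[OF assms(1)]
  using X_cong[OF assms(1,2,3), of a b c] assms(1,3) by simp

text \<open>The sum consists of six terms \<nabla>P, which cancel in pairs because \<nabla>_a P is
  symmetric along with P.\<close>

lemma cotton_cyclic:
  assumes "p \<in> U" "\<And>q b c. q \<in> U \<Longrightarrow> schouten A N X \<theta> b c q = schouten A N X \<theta> c b q"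
  shows "cotton A N X \<theta> a b c p + cotton A N X \<theta> b c a p + cotton A N X \<theta> c a b p = 0"
proof -
  have "nab2 a (schouten A N X \<theta>) b c p = nab2 a (schouten A N X \<theta>) c b p" for a b c
    by (rule nabla2_sym[where T = "schouten A N X \<theta>", OF assms(1) smooth_schouten assms(2)])
  from this[of a b c] this[of b c a] this[of c a b] show ?thesis
    unfolding cotton_nabla by linarith
qed

section \<open>The Leibniz rule for contractions\<close>

text \<open>The left side is \<nabla>_a of the covector T_bc u^c. The last bracket is \<nabla>_a u^c
  written out, the form in which the equation for D\<mu> is substituted.\<close>

lemma Leibniz2:
  assumes p: "p \<in> U" and T: "\<And>b c. smooth (T b c)" and u: "\<And>c. smooth (u c)"
  shows "X a p (\<lambda>q. \<Sum>c\<in>UNIV. T b c q * u c q) - (\<Sum>e\<in>UNIV. \<Gamma> e b a p * (\<Sum>c\<in>UNIV. T e c p * u c p))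
    = (\<Sum>c\<in>UNIV. nab2 a T b c p * u c p)
      + (\<Sum>c\<in>UNIV. T b c p * (X a p (u c) + (\<Sum>e\<in>UNIV. \<Gamma> c e a p * u e p)))"
proof -
  have "X a p (\<lambda>q. \<Sum>c\<in>UNIV. T b c q * u c q) = (\<Sum>c\<in>UNIV. X a p (T b c) * u c p + T b c p * X a p (u c))"
    using assms by (simp add: X_sum X_mult smooth_mult)
  moreover have "(\<Sum>e\<in>UNIV. \<Gamma> e b a p * (\<Sum>c\<in>UNIV. T e c p * u c p))
      = (\<Sum>c\<in>UNIV. (\<Sum>e\<in>UNIV. \<Gamma> e b a p * T e c p) * u c p)"
    unfolding sum_distrib_left sum_distrib_right by (subst sum.swap) (simp add: mult.assoc)
  \<comment> \<open>The connection terms in the contracted index occur with opposite signs in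
    \<nabla>T and \<nabla>u, and agree after renaming c and e.\<close>
  moreover have "(\<Sum>c\<in>UNIV. (\<Sum>e\<in>UNIV. \<Gamma> e c a p * T b e p) * u c p)
      = (\<Sum>c\<in>UNIV. T b c p * (\<Sum>e\<in>UNIV. \<Gamma> c e a p * u e p))"
    unfolding sum_distrib_left sum_distrib_right by (subst sum.swap) (simp add: ac_simps)
  ultimately show ?thesis
    unfolding nabla2_frame[OF p]
    by (simp only: distrib_left left_diff_distrib sum.distrib sum_subtractf)
qed

text \<open>As in \<open>Leibniz2\<close> with two contracted indices; the connection terms for b, c
  and d are matched one slot at a time.\<close>

lemma Leibniz3:
  assumes p: "p \<in> U" and T: "\<And>b c d. smooth (T b c d)" and u: "\<And>c d. smooth (u c d)"
  shows "X a p (\<lambda>q. \<Sum>c\<in>UNIV. \<Sum>d\<in>UNIV. T b c d q * u c d q)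
      - (\<Sum>e\<in>UNIV. \<Gamma> e b a p * (\<Sum>c\<in>UNIV. \<Sum>d\<in>UNIV. T e c d p * u c d p))
    = (\<Sum>c\<in>UNIV. \<Sum>d\<in>UNIV. nab3 a T b c d p * u c d p)
      + (\<Sum>c\<in>UNIV. \<Sum>d\<in>UNIV. T b c d p *
          (X a p (u c d) + (\<Sum>e\<in>UNIV. \<Gamma> c e a p * u e d p) + (\<Sum>e\<in>UNIV. \<Gamma> d e a p * u c e p)))"
proof -
  have "X a p (\<lambda>q. \<Sum>c\<in>UNIV. \<Sum>d\<in>UNIV. T b c d q * u c d q)
      = (\<Sum>c\<in>UNIV. \<Sum>d\<in>UNIV. X a p (T b c d) * u c d p + T b c d p * X a p (u c d))"
    using assms by (simp add: X_sum X_mult smooth_mult smooth_sum)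
  moreover have "(\<Sum>e\<in>UNIV. \<Gamma> e b a p * (\<Sum>c\<in>UNIV. \<Sum>d\<in>UNIV. T e c d p * u c d p))
      = (\<Sum>c\<in>UNIV. \<Sum>d\<in>UNIV. (\<Sum>e\<in>UNIV. \<Gamma> e b a p * T e c d p) * u c d p)"
  proof -
    have "(\<Sum>e\<in>UNIV. \<Sum>c\<in>UNIV. \<Sum>d\<in>UNIV. \<Gamma> e b a p * T e c d p * u c d p)
        = (\<Sum>c\<in>UNIV. \<Sum>e\<in>UNIV. \<Sum>d\<in>UNIV. \<Gamma> e b a p * T e c d p * u c d p)"
      by (rule sum.swap)
    also have "\<dots> = (\<Sum>c\<in>UNIV. \<Sum>d\<in>UNIV. \<Sum>e\<in>UNIV. \<Gamma> e b a p * T e c d p * u c d p)"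
      by (intro sum.cong refl sum.swap)
    finally show ?thesis
      unfolding sum_distrib_left sum_distrib_right by (simp add: mult.assoc)
  qed
  moreover have "(\<Sum>c\<in>UNIV. \<Sum>d\<in>UNIV. (\<Sum>e\<in>UNIV. \<Gamma> e c a p * T b e d p) * u c d p)
      = (\<Sum>c\<in>UNIV. \<Sum>d\<in>UNIV. T b c d p * (\<Sum>e\<in>UNIV. \<Gamma> c e a p * u e d p))"
  proof -
    \<comment> \<open>Only adjacent sums can be swapped, so exchanging c with e across d takes three
      transpositions.\<close>
    have "(\<Sum>c\<in>UNIV. \<Sum>d\<in>UNIV. \<Sum>e\<in>UNIV. \<Gamma> e c a p * T b e d p * u c d p)
        = (\<Sum>d\<in>UNIV. \<Sum>c\<in>UNIV. \<Sum>e\<in>UNIV. \<Gamma> e c a p * T b e d p * u c d p)"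
      by (rule sum.swap)
    also have "\<dots> = (\<Sum>d\<in>UNIV. \<Sum>e\<in>UNIV. \<Sum>c\<in>UNIV. \<Gamma> e c a p * T b e d p * u c d p)"
      by (intro sum.cong refl sum.swap)
    also have "\<dots> = (\<Sum>e\<in>UNIV. \<Sum>d\<in>UNIV. \<Sum>c\<in>UNIV. \<Gamma> e c a p * T b e d p * u c d p)"
      by (rule sum.swap)
    finally show ?thesis
      unfolding sum_distrib_left sum_distrib_right by (simp add: ac_simps)
  qed
  moreover have "(\<Sum>c\<in>UNIV. \<Sum>d\<in>UNIV. (\<Sum>e\<in>UNIV. \<Gamma> e d a p * T b c e p) * u c d p)
      = (\<Sum>c\<in>UNIV. \<Sum>d\<in>UNIV. T b c d p * (\<Sum>e\<in>UNIV. \<Gamma> d e a p * u c e p))"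
  proof (rule sum.cong[OF refl])
    fix c
    have "(\<Sum>d\<in>UNIV. \<Sum>e\<in>UNIV. \<Gamma> e d a p * T b c e p * u c d p)
        = (\<Sum>e\<in>UNIV. \<Sum>d\<in>UNIV. \<Gamma> e d a p * T b c e p * u c d p)"
      by (rule sum.swap)
    then show "(\<Sum>d\<in>UNIV. (\<Sum>e\<in>UNIV. \<Gamma> e d a p * T b c e p) * u c d p)
        = (\<Sum>d\<in>UNIV. T b c d p * (\<Sum>e\<in>UNIV. \<Gamma> d e a p * u c e p))"
      unfolding sum_distrib_left sum_distrib_right by (simp add: ac_simps)
  qed
  ultimately show ?thesis
    unfolding nabla3_frame[OF p]
    by (simp only: distrib_left left_diff_distrib sum.distrib sum_subtractf)
qed

section \<open>The antisymmetrized derivative of the prescribed D\<rho>\<close>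

lemma U_tensor_contract:
  assumes g: "\<And>c d. gc c d p = gc d c p"
  shows "(\<Sum>c\<in>UNIV. \<Sum>d\<in>UNIV. U_tensor A N X \<theta> a b c d p * gc c d p) =
    ((\<Sum>c\<in>UNIV. \<Sum>d\<in>UNIV. nab3 a (cotton A N X \<theta>) b c d p * gc c d p)
      - (\<Sum>c\<in>UNIV. \<Sum>d\<in>UNIV. nab3 b (cotton A N X \<theta>) a c d p * gc c d p)
      + (\<Sum>e\<in>UNIV. schouten A N X \<theta> b e p * (\<Sum>c\<in>UNIV. \<Sum>d\<in>UNIV. weyl A N X \<theta> e c d a p * gc c d p))
      - (\<Sum>e\<in>UNIV. schouten A N X \<theta> a e p * (\<Sum>c\<in>UNIV. \<Sum>d\<in>UNIV. weyl A N X \<theta> e c d b p * gc c d p))) / 2"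
proof -
  \<comment> \<open>The tensor U before symmetrization over c and d; contraction with the symmetric
    \<open>gc\<close> does not distinguish the two.\<close>
  define t where "t c d = (nab3 a (cotton A N X \<theta>) b c d p - nab3 b (cotton A N X \<theta>) a c d p
      + (\<Sum>e\<in>UNIV. weyl A N X \<theta> e c d a p * schouten A N X \<theta> b e p)
      - (\<Sum>e\<in>UNIV. weyl A N X \<theta> e c d b p * schouten A N X \<theta> a e p)) / 2" for c d
  have U_t: "U_tensor A N X \<theta> a b c d p = (t c d + t d c) / 2" for c d
    unfolding U_tensor_def nabla_cotton_def t_def
    by (simp add: distrib_right left_diff_distrib add_divide_distrib diff_divide_distrib sum.distrib
        sum_subtractf flip: sum_divide_distrib)
  have "(\<Sum>c\<in>UNIV. \<Sum>d\<in>UNIV. U_tensor A N X \<theta> a b c d p * gc c d p)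
      = (\<Sum>c\<in>UNIV. \<Sum>d\<in>UNIV. t c d * gc c d p)"
    unfolding U_t by (rule sum_sym_contract) (rule g)
  moreover have "(\<Sum>c\<in>UNIV. \<Sum>d\<in>UNIV. (\<Sum>e\<in>UNIV. weyl A N X \<theta> e c d a p * schouten A N X \<theta> b e p) * gc c d p)
      = (\<Sum>e\<in>UNIV. schouten A N X \<theta> b e p * (\<Sum>c\<in>UNIV. \<Sum>d\<in>UNIV. weyl A N X \<theta> e c d a p * gc c d p))" for a b
  proof -
    have "(\<Sum>e\<in>UNIV. \<Sum>c\<in>UNIV. \<Sum>d\<in>UNIV. weyl A N X \<theta> e c d a p * schouten A N X \<theta> b e p * gc c d p)
        = (\<Sum>c\<in>UNIV. \<Sum>e\<in>UNIV. \<Sum>d\<in>UNIV. weyl A N X \<theta> e c d a p * schouten A N X \<theta> b e p * gc c d p)"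
      by (rule sum.swap)
    also have "\<dots> = (\<Sum>c\<in>UNIV. \<Sum>d\<in>UNIV. \<Sum>e\<in>UNIV. weyl A N X \<theta> e c d a p * schouten A N X \<theta> b e p * gc c d p)"
      by (intro sum.cong refl sum.swap)
    finally show ?thesis
      unfolding sum_distrib_left sum_distrib_right by (simp add: ac_simps)
  qed
  ultimately show ?thesis
    by (simp add: t_def distrib_right left_diff_distrib add_divide_distrib diff_divide_distrib
        sum.distrib sum_subtractf flip: sum_divide_distrib)
qed

text \<open>The result is a nonzero multiple of the difference of the two sides of the claimed
  condition. The system enters at the point \<open>p\<close>, but the symmetry of P on all of
  \<open>U\<close>, because the cyclic identity differentiates it.\<close>

lemma antisym_nabla_rhs:
  fixes P W Y n
  defines "P \<equiv> schouten A N X \<theta>" and "W \<equiv> weyl A N X \<theta>" and "Y \<equiv> cotton A N X \<theta>"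
    and "n \<equiv> real CARD('n)"
  assumes p: "p \<in> U"
    and P_sym: "\<And>q b c. q \<in> U \<Longrightarrow> P b c q = P c b q"
    and g_sym: "\<And>c d. gc c d p = gc d c p"
    and g: "\<And>c d. smooth (gc c d)" and m: "\<And>c. smooth (\<mu>c c)"
    and Dg: "\<And>a b c. X a p (gc b c) + (\<Sum>e\<in>UNIV. \<Gamma> b e a p * gc e c p) + (\<Sum>e\<in>UNIV. \<Gamma> c e a p * gc b e p)
        = \<mu>c c p * (if b = a then 1 else 0) + \<mu>c b p * (if c = a then 1 else 0)"
    and Dm: "\<And>a b. X a p (\<mu>c b) + (\<Sum>e\<in>UNIV. \<Gamma> b e a p * \<mu>c e p)
        = \<rho> p * (if b = a then 1 else 0) - (\<Sum>c\<in>UNIV. P a c p * gc b c p)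
          - 1 / n * (\<Sum>c\<in>UNIV. \<Sum>d\<in>UNIV. W b c d a p * gc c d p)"
    and s: "\<And>b q. s b q = - 2 * (\<Sum>c\<in>UNIV. P b c q * \<mu>c c q)
        + 2 / n * (\<Sum>c\<in>UNIV. \<Sum>d\<in>UNIV. Y b c d q * gc c d q)"
  shows "X a p (s b) - X b p (s a) - (\<Sum>e\<in>UNIV. s e p * (\<Gamma> e b a p - \<Gamma> e a b p)) =
    4 / n * ((\<Sum>c\<in>UNIV. \<Sum>d\<in>UNIV. U_tensor A N X \<theta> a b c d p * gc c d p)
      + (n + 3) / 2 * (\<Sum>c\<in>UNIV. Y b a c p * \<mu>c c p))"
proof -
  have n: "n \<noteq> 0" by (simp add: n_def)
  have sm: "smooth (P b c)" "smooth (Y b c d)" for b c d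
    by (simp_all add: P_def Y_def smooth_intros)
  \<comment> \<open>\<open>S1\<close> and \<open>S2\<close> are the two contractions in
    \<open>s\<close>. Differentiating \<open>S1\<close> yields \<open>M\<close> from \<nabla>P,
    \<open>Q\<close> quadratic in P and the Weyl term \<open>R\<close>; differentiating
    \<open>S2\<close> yields \<open>C\<close> from \<nabla>Y and the terms \<open>Z1\<close>,
    \<open>Z2\<close> in \<mu>.\<close>
  define S1 where "S1 b q = (\<Sum>c\<in>UNIV. P b c q * \<mu>c c q)" for b q
  define S2 where "S2 b q = (\<Sum>c\<in>UNIV. \<Sum>d\<in>UNIV. Y b c d q * gc c d q)" for b q
  define w where "w e a = (\<Sum>c\<in>UNIV. \<Sum>d\<in>UNIV. W e c d a p * gc c d p)" for e a
  define Q where "Q a b = (\<Sum>c\<in>UNIV. P b c p * (\<Sum>d\<in>UNIV. P a d p * gc c d p))" for a b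
  define R where "R a b = (\<Sum>e\<in>UNIV. P b e p * w e a)" for a b
  define M where "M a b = (\<Sum>c\<in>UNIV. nab2 a P b c p * \<mu>c c p)" for a b
  define C where "C a b = (\<Sum>c\<in>UNIV. \<Sum>d\<in>UNIV. nab3 a Y b c d p * gc c d p)" for a b
  define Z1 where "Z1 a b = (\<Sum>c\<in>UNIV. Y a b c p * \<mu>c c p)" for a b
  define Z2 where "Z2 a b = (\<Sum>c\<in>UNIV. Y a c b p * \<mu>c c p)" for a b

  have S: "smooth (S1 b)" "smooth (S2 b)" for b
    unfolding S1_def[abs_def] S2_def[abs_def] by (intro smooth_intros sm g m)+
  have "s = (\<lambda>b q. - 2 * S1 b q + 2 / n * S2 b q)"
    by (simp add: fun_eq_iff s S1_def S2_def)
  then have Xs: "X a p (s b) = - 2 * X a p (S1 b) + 2 / n * X a p (S2 b)"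
    and sp: "s e p = - 2 * S1 e p + 2 / n * S2 e p" for a b e
    using X_scale[OF p S(1), of a "-2" b] X_scale[OF p S(2), of a "2 / n" b]
      X_add[OF p smooth_mult[OF smooth_const S(1)] smooth_mult[OF smooth_const S(2)], of a "-2" b "2 / n" b]
    by simp_all

  have D1: "X a p (S1 b) - (\<Sum>e\<in>UNIV. \<Gamma> e b a p * S1 e p) = M a b + \<rho> p * P b a p - Q a b - 1 / n * R a b" for a b
  proof -
    have "(\<Sum>c\<in>UNIV. P b c p * (\<rho> p * (if c = a then 1 else 0))) = \<rho> p * P b a p"
      by (simp add: if_distrib sum.delta cong: if_cong)
    moreover have "(\<Sum>c\<in>UNIV. P b c p * (1 / n * w c a)) = 1 / n * R a b"
      by (simp add: R_def flip: sum_divide_distrib)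
    ultimately have "(\<Sum>c\<in>UNIV. P b c p * (\<rho> p * (if c = a then 1 else 0) - (\<Sum>d\<in>UNIV. P a d p * gc c d p) - 1 / n * w c a))
       = \<rho> p * P b a p - Q a b - 1 / n * R a b"
      by (simp only: right_diff_distrib sum_subtractf Q_def)
    then show ?thesis
      using Leibniz2[of p P \<mu>c a b, OF p sm(1) m] unfolding S1_def[abs_def] M_def Dm w_def by simp
  qed
  \<comment> \<open>In the equation for Dg one Kronecker delta sets c = a and gives
    \<open>Z1\<close>, the other sets d = a and gives \<open>Z2\<close>.\<close>
  have D2: "X a p (S2 b) - (\<Sum>e\<in>UNIV. \<Gamma> e b a p * S2 e p) = C a b + Z1 b a + Z2 b a" for a b
  proof -
    have "(\<Sum>d\<in>UNIV. Y b c d p * (\<mu>c c p * (if d = a then 1 else 0))) = Y b c a p * \<mu>c c p" for c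
      by (simp add: if_distrib sum.delta cong: if_cong)
    then have "(\<Sum>d\<in>UNIV. Y b c d p * (\<mu>c d p * (if c = a then 1 else 0) + \<mu>c c p * (if d = a then 1 else 0)))
        = (if c = a then Z1 b a else 0) + Y b c a p * \<mu>c c p" for c
      by (simp add: distrib_left sum.distrib Z1_def)
    then have "(\<Sum>c\<in>UNIV. \<Sum>d\<in>UNIV. Y b c d p * (\<mu>c d p * (if c = a then 1 else 0) + \<mu>c c p * (if d = a then 1 else 0)))
        = Z1 b a + Z2 b a"
      by (simp add: sum.distrib Z2_def)
    then show ?thesis
      using Leibniz3[of p Y gc a b, OF p sm(2) g] unfolding S2_def[abs_def] C_def Dg by simp
  qed

  \<comment> \<open>This and the symmetry of P make the quadratic and the \<rho> terms vanish under
    antisymmetrization in a, b.\<close>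
  have Q_sym: "Q a b = Q b a"
    unfolding Q_def sum_distrib_left by (subst sum.swap) (simp add: g_sym ac_simps)
  have MZ: "M a b - M b a = - Z1 b a"
    by (simp add: M_def Z1_def Y_def P_def cotton_nabla left_diff_distrib sum_subtractf)
  have Z1_anti: "Z1 a b = - Z1 b a"
    by (simp add: Z1_def Y_def cotton_nabla left_diff_distrib sum_subtractf)
  \<comment> \<open>The cyclic identity, with Y_cab = -Y_acb, expresses the antisymmetric part of
    \<open>Z2\<close> through \<open>Z1\<close>.\<close>
  have "Y b c a p - Y a c b p = - Y a b c p" for c
    using cotton_cyclic[OF p, of a b c] P_sym cotton_nabla[of c a b p] cotton_nabla[of a c b p]
    by (simp add: P_def Y_def)
  then have Z2_cyc: "Z2 b a - Z2 a b = Z1 b a"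
    using Z1_anti by (simp add: Z2_def Z1_def sum_negf flip: sum_subtractf left_diff_distrib)
  have Uc: "(\<Sum>c\<in>UNIV. \<Sum>d\<in>UNIV. U_tensor A N X \<theta> a b c d p * gc c d p) = (C a b - C b a + R a b - R b a) / 2"
    unfolding U_tensor_contract[of gc p a b, OF g_sym] C_def R_def w_def P_def W_def Y_def ..
  have "(\<Sum>e\<in>UNIV. s e p * (\<Gamma> e b a p - \<Gamma> e a b p)) =
     - 2 * ((\<Sum>e\<in>UNIV. \<Gamma> e b a p * S1 e p) - (\<Sum>e\<in>UNIV. \<Gamma> e a b p * S1 e p))
     + 2 / n * ((\<Sum>e\<in>UNIV. \<Gamma> e b a p * S2 e p) - (\<Sum>e\<in>UNIV. \<Gamma> e a b p * S2 e p))"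
    unfolding sp sum_subtractf[symmetric] sum_distrib_left sum.distrib[symmetric]
    by (intro sum.cong refl) (simp add: algebra_simps)
  then have "X a p (s b) - X b p (s a) - (\<Sum>e\<in>UNIV. s e p * (\<Gamma> e b a p - \<Gamma> e a b p)) =
     - 2 * ((X a p (S1 b) - (\<Sum>e\<in>UNIV. \<Gamma> e b a p * S1 e p)) - (X b p (S1 a) - (\<Sum>e\<in>UNIV. \<Gamma> e a b p * S1 e p)))
     + 2 / n * ((X a p (S2 b) - (\<Sum>e\<in>UNIV. \<Gamma> e b a p * S2 e p)) - (X b p (S2 a) - (\<Sum>e\<in>UNIV. \<Gamma> e a b p * S2 e p)))"
    unfolding Xs by (simp add: algebra_simps)
  also have "\<dots> = - 2 * ((M a b - M b a) - 1 / n * (R a b - R b a))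
      + 2 / n * (C a b - C b a + (Z1 b a - Z1 a b) + (Z2 b a - Z2 a b))"
    unfolding D1 D2 using Q_sym P_sym[OF p, of a b] by (simp add: algebra_simps)
  \<comment> \<open>Origin of n + 3: the antisymmetry of \<open>Z1\<close> contributes 2 and the
    cyclic identity 1 to the factor 3, while \<nabla>P contributes 2 \<open>Z1\<close>, that is n
    inside the common factor 2/n.\<close>
  also have "\<dots> = 2 * Z1 b a + 2 / n * (R a b - R b a + C a b - C b a + 3 * Z1 b a)"
    unfolding MZ Z2_cyc Z1_anti by (simp add: algebra_simps)
  also have "\<dots> = 4 / n * ((C a b - C b a + R a b - R b a) / 2 + (n + 3) / 2 * Z1 b a)"
    using n by (simp add: field_simps)
  finally show ?thesis
    unfolding Uc Z1_def .
qed

end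

section \<open>The integrability condition\<close>

text \<open>With empty index lists \<open>cov_D1\<close> is \<open>ext_deriv\<close>, and both
  readings of the condition concern a 1-form with the values of \<open>rhs_\<rho>\<close> on tangent
  vectors over \<open>U\<close>; \<open>key\<close> treats every such form.\<close>

theorem proposition2p18:
  fixes A :: "('m::{t2_space,second_countable_topology}, 'n::finite) atlas"
    and N :: "'m vfield \<Rightarrow> 'm vfield \<Rightarrow> 'm vfield"
    and U :: "'m set"
    and X :: "'n \<Rightarrow> 'm vfield"
    and \<theta> :: "'n \<Rightarrow> 'm oneform"
    and g :: "'m \<Rightarrow> ('m tangent \<Rightarrow> real) \<Rightarrow> ('m tangent \<Rightarrow> real) \<Rightarrow> real"
    and \<mu> :: "'m vfield"
    and \<rho> :: "'m \<Rightarrow> real"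
    and n :: real
    and P :: "'n \<Rightarrow> 'n \<Rightarrow> 'm \<Rightarrow> real"
    and W :: "'n \<Rightarrow> 'n \<Rightarrow> 'n \<Rightarrow> 'n \<Rightarrow> 'm \<Rightarrow> real"
    and Y :: "'n \<Rightarrow> 'n \<Rightarrow> 'n \<Rightarrow> 'm \<Rightarrow> real"
    and \<omega> :: "'n \<Rightarrow> 'm oneform"
    and gc :: "'n \<Rightarrow> 'n \<Rightarrow> 'm \<Rightarrow> real"
    and \<mu>c :: "'n \<Rightarrow> 'm \<Rightarrow> real"
    and rhs_\<rho> :: "'m oneform"
  defines "n \<equiv> real CARD('n)"
    and "P \<equiv> schouten A N X \<theta>"
    and "W \<equiv> weyl A N X \<theta>"
    and "Y \<equiv> cotton A N X \<theta>"
    and "\<omega> \<equiv> omega A N X \<theta>"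
    and "gc \<equiv> bivec_comp \<theta> g"
    and "\<mu>c \<equiv> vec_comp \<theta> \<mu>"
    and "rhs_\<rho> \<equiv> \<lambda>p v. - 2 * (\<Sum>b\<in>UNIV. \<omega> b p v * \<mu>c b p)
           + 2 / n * (\<Sum>a\<in>UNIV. \<Sum>b\<in>UNIV. \<Sum>c\<in>UNIV. Y a b c p * gc b c p * \<theta> a p v)"
  assumes dim: "CARD('n) \<ge> 2"
    and manifold: "smooth_manifold A"
    and connection: "affine_connection A N" "torsion_free A N"
    and frame: "local_frame A U X \<theta>"
    and schouten_sym: "\<forall>p\<in>U. \<forall>a b. P a b p = P b a p"
    and fields: "sym_bivector_field A UNIV g" "vector_field A UNIV \<mu>" "smooth_fun A UNIV \<rho>"
    and eq_g: "\<And>b c. oneform_eq_on A U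
           (cov_D N X \<theta> (\<lambda>is _. gc (is ! 0) (is ! 1)) [b, c] [])
           (\<lambda>p v. \<mu>c c p * \<theta> b p v + \<mu>c b p * \<theta> c p v)"
    and eq_\<mu>: "\<And>b. oneform_eq_on A U
           (cov_D N X \<theta> (\<lambda>is _. \<mu>c (is ! 0)) [b] [])
           (\<lambda>p v. \<rho> p * \<theta> b p v - (\<Sum>c\<in>UNIV. \<omega> c p v * gc b c p)
              - 1 / n * (\<Sum>a\<in>UNIV. \<Sum>c\<in>UNIV. \<Sum>d\<in>UNIV. W b c d a p * gc c d p * \<theta> a p v))"
  shows
    \<comment> \<open>with the third equation: D applied to D rho, which is a 2-form given by its frame components\<close>
    "(oneform_eq_on A U (cov_D N X \<theta> (\<lambda>_ _. \<rho>) [] []) rhs_\<rho> \<longrightarrow>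
        (\<forall>p\<in>U. (\<forall>a b. cov_D1 A N X \<theta> (cov_D N X \<theta> (\<lambda>_ _. \<rho>)) [] [] (X a) (X b) p = 0)
          \<longleftrightarrow> (\<forall>a b. (\<Sum>c\<in>UNIV. \<Sum>d\<in>UNIV. U_tensor A N X \<theta> a b c d p * gc c d p)
                  = - ((n + 3) / 2) * (\<Sum>c\<in>UNIV. Y b a c p * \<mu>c c p))))
     \<comment> \<open>the same, with D rho replaced by its prescribed value, whose D does not vanish identically\<close>
     \<and> (\<forall>p\<in>U. (\<forall>a b. cov_D1 A N X \<theta> (\<lambda>_ _. rhs_\<rho>) [] [] (X a) (X b) p = 0)
          \<longleftrightarrow> (\<forall>a b. (\<Sum>c\<in>UNIV. \<Sum>d\<in>UNIV. U_tensor A N X \<theta> a b c d p * gc c d p)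
                  = - ((n + 3) / 2) * (\<Sum>c\<in>UNIV. Y b a c p * \<mu>c c p)))"
proof -
  interpret framed_connection A N U X \<theta>
    by unfold_locales (fact manifold connection frame)+
  define s where "s b q = - 2 * (\<Sum>c\<in>UNIV. P b c q * \<mu>c c q)
        + 2 / n * (\<Sum>c\<in>UNIV. \<Sum>d\<in>UNIV. Y b c d q * gc c d q)" for b q
  have g: "smooth (gc c d)" for c d
    using fields(1) theta_form open_U unfolding sym_bivector_field_def gc_def bivec_comp_def[abs_def]
    by blast
  have g_sym: "gc c d p = gc d c p" if "p \<in> U" for c d p
    unfolding gc_def bivec_comp_def
    by (rule fields(1)[unfolded sym_bivector_field_def, THEN conjunct1, rule_format, THEN conjunct1])
       (simp_all add: theta_cotangent that)
  have "vector_field A U \<mu>"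
    using fields(2) by (auto simp: vector_field_def)
  then have m: "smooth (\<mu>c c)" for c
    using theta_form[of c] open_U unfolding one_form_def \<mu>c_def vec_comp_def[abs_def]
    by blast
  have omega_frame: "\<omega> b p (X a p) = P a b p" if "p \<in> U" for a b p
    using that by (simp add: \<omega>_def P_def omega_def dual if_distrib if_distribR sum.delta cong: if_cong)
  \<comment> \<open>Evaluating the form equations on the frame vector X_a turns \<theta>^b into a
    Kronecker delta and \<open>conn_form\<close> into \<Gamma>.\<close>
  have Dg: "X a p (gc b c) + (\<Sum>e\<in>UNIV. \<Gamma> b e a p * gc e c p) + (\<Sum>e\<in>UNIV. \<Gamma> c e a p * gc b e p)
        = \<mu>c c p * (if b = a then 1 else 0) + \<mu>c b p * (if c = a then 1 else 0)"
    if "p \<in> U" for a b c p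
    using eq_g[of b c] X_tangent[OF that, of a] that
    by (auto simp: oneform_eq_on_def cov_D_def conn_form_frame dual lessThan_Suc numeral_2_eq_2 add_ac
        dest!: bspec)
  have Dm: "X a p (\<mu>c b) + (\<Sum>e\<in>UNIV. \<Gamma> b e a p * \<mu>c e p)
        = \<rho> p * (if b = a then 1 else 0) - (\<Sum>c\<in>UNIV. P a c p * gc b c p)
          - 1 / n * (\<Sum>c\<in>UNIV. \<Sum>d\<in>UNIV. W b c d a p * gc c d p)"
    if "p \<in> U" for a b p
  proof -
    have "(\<Sum>i\<in>UNIV. \<Sum>c\<in>UNIV. \<Sum>d\<in>UNIV. W b c d i p * gc c d p * (if i = a then 1 else 0))
      = (\<Sum>i\<in>UNIV. (if i = a then \<Sum>c\<in>UNIV. \<Sum>d\<in>UNIV. W b c d i p * gc c d p else 0))"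
      by (intro sum.cong refl) auto
    then have "(\<Sum>i\<in>UNIV. \<Sum>c\<in>UNIV. \<Sum>d\<in>UNIV. W b c d i p * gc c d p * (if i = a then 1 else 0))
      = (\<Sum>c\<in>UNIV. \<Sum>d\<in>UNIV. W b c d a p * gc c d p)"
      by simp
    moreover have "cov_D N X \<theta> (\<lambda>is _. \<mu>c (is ! 0)) [b] [] p (X a p)
      = \<rho> p * \<theta> b p (X a p) - (\<Sum>c\<in>UNIV. \<omega> c p (X a p) * gc b c p)
              - 1 / n * (\<Sum>i\<in>UNIV. \<Sum>c\<in>UNIV. \<Sum>d\<in>UNIV. W b c d i p * gc c d p * \<theta> i p (X a p))"
      using eq_\<mu>[of b] X_tangent[OF that, of a] that unfolding oneform_eq_on_def by blast
    ultimately show ?thesis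
      using that by (simp add: cov_D_def conn_form_frame dual omega_frame)
  qed
  have rhs: "rhs_\<rho> q v = (\<Sum>e\<in>UNIV. s e q * \<theta> e q v)" for q v
  proof -
    \<comment> \<open>Since \<omega>_b = \<theta>^a P_ab, the form index is the first index of P;
      swapping the sums collects the coefficient of each \<theta>^e.\<close>
    have "(\<Sum>b\<in>UNIV. \<omega> b q v * \<mu>c b q) = (\<Sum>e\<in>UNIV. (\<Sum>c\<in>UNIV. P e c q * \<mu>c c q) * \<theta> e q v)"
      unfolding \<omega>_def omega_def P_def sum_distrib_right by (subst sum.swap) (simp add: ac_simps)
    moreover have "(\<Sum>e\<in>UNIV. s e q * \<theta> e q v)
        = - 2 * (\<Sum>e\<in>UNIV. (\<Sum>c\<in>UNIV. P e c q * \<mu>c c q) * \<theta> e q v)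
          + 2 / n * (\<Sum>e\<in>UNIV. (\<Sum>c\<in>UNIV. \<Sum>d\<in>UNIV. Y e c d q * gc c d q) * \<theta> e q v)"
      by (simp only: s_def distrib_right sum.distrib mult.assoc flip: sum_distrib_left)
    ultimately show ?thesis
      by (simp add: rhs_\<rho>_def sum_distrib_right)
  qed
  have s: "smooth (s e)" for e
    unfolding s_def[abs_def] P_def Y_def by (intro smooth_intros g m)
  have n: "n > 0" by (simp add: n_def)
  have key: "(\<forall>a b. ext_deriv A \<sigma> (X a) (X b) p = 0)
          \<longleftrightarrow> (\<forall>a b. (\<Sum>c\<in>UNIV. \<Sum>d\<in>UNIV. U_tensor A N X \<theta> a b c d p * gc c d p)
                  = - ((n + 3) / 2) * (\<Sum>c\<in>UNIV. Y b a c p * \<mu>c c p))"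
    if p: "p \<in> U" and \<sigma>: "\<And>q v. q \<in> U \<Longrightarrow> v \<in> tangent_space A q \<Longrightarrow> \<sigma> q v = rhs_\<rho> q v" for p \<sigma>
  proof -
    have "ext_deriv A \<sigma> (X a) (X b) p =
      4 / n * ((\<Sum>c\<in>UNIV. \<Sum>d\<in>UNIV. U_tensor A N X \<theta> a b c d p * gc c d p)
      + (n + 3) / 2 * (\<Sum>c\<in>UNIV. Y b a c p * \<mu>c c p))" for a b
    proof -
      have "ext_deriv A \<sigma> (X a) (X b) p =
          X a p (s b) - X b p (s a) - (\<Sum>e\<in>UNIV. s e p * (\<Gamma> e b a p - \<Gamma> e a b p))"
        by (rule ext_deriv_frame[OF p s]) (simp add: \<sigma> rhs)
      also have "\<dots> = 4 / n * ((\<Sum>c\<in>UNIV. \<Sum>d\<in>UNIV. U_tensor A N X \<theta> a b c d p * gc c d p)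
          + (n + 3) / 2 * (\<Sum>c\<in>UNIV. Y b a c p * \<mu>c c p))"
        unfolding Y_def n_def
      proof (rule antisym_nabla_rhs[where \<rho> = \<rho>, OF p _ g_sym[OF p] g m Dg[OF p]])
        show "schouten A N X \<theta> b c q = schouten A N X \<theta> c b q" if "q \<in> U" for q b c
          using schouten_sym that unfolding P_def by blast
      qed (use Dm[OF p] in \<open>simp_all add: s_def P_def W_def Y_def n_def\<close>)
      finally show ?thesis .
    qed
    \<comment> \<open>The factor 4/n is nonzero, so the exterior derivative vanishes exactly when
      the bracket does.\<close>
    moreover have "4 / n * (x + (n + 3) / 2 * y) = 0 \<longleftrightarrow> x = - ((n + 3) / 2) * y" for x y
      using n by (simp only: mult_eq_0_iff divide_eq_0_iff minus_mult_left[symmetric] eq_neg_iff_add_eq_0) simp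
    ultimately show ?thesis
      by presburger
  qed
  show ?thesis
  proof (intro conjI impI ballI)
    fix p
    assume "oneform_eq_on A U (cov_D N X \<theta> (\<lambda>_ _. \<rho>) [] []) rhs_\<rho>" "p \<in> U"
    then show "(\<forall>a b. cov_D1 A N X \<theta> (cov_D N X \<theta> (\<lambda>_ _. \<rho>)) [] [] (X a) (X b) p = 0)
          \<longleftrightarrow> (\<forall>a b. (\<Sum>c\<in>UNIV. \<Sum>d\<in>UNIV. U_tensor A N X \<theta> a b c d p * gc c d p)
                  = - ((n + 3) / 2) * (\<Sum>c\<in>UNIV. Y b a c p * \<mu>c c p))"
      using key[of p "cov_D N X \<theta> (\<lambda>_ _. \<rho>) [] []"] by (simp add: cov_D1_def oneform_eq_on_def)
  next
    fix p
    assume "p \<in> U"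
    then show "(\<forall>a b. cov_D1 A N X \<theta> (\<lambda>_ _. rhs_\<rho>) [] [] (X a) (X b) p = 0)
          \<longleftrightarrow> (\<forall>a b. (\<Sum>c\<in>UNIV. \<Sum>d\<in>UNIV. U_tensor A N X \<theta> a b c d p * gc c d p)
                  = - ((n + 3) / 2) * (\<Sum>c\<in>UNIV. Y b a c p * \<mu>c c p))"
      using key[of p rhs_\<rho>] by (simp add: cov_D1_def)
  qed
qed

end
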